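(* Let $k$ be a time index and consider the measurement error equation $$\delta\mathbf{y}_k=\mathbf{H}_k\,\delta\mathbf{x}_k+\mathbf{B}_\rho\,\boldsymbol{\rho}_k+\mathbf{B}_v\,\mathbf{v}_k,\qquad \boldsymbol{\rho}_k=\mathbf{\Delta}_k(\boldsymbol{\mu}_k),\qquad \boldsymbol{\mu}_k=\mathbf{C}_\mu\,\delta\mathbf{x}_k,$$ where $\delta\mathbf{x}_k$ is a random vector in $\mathbb{R}^n$, $\delta\mathbf{y}_k$ a random vector in $\mathbb{R}^{n_y}$, $\boldsymbol{\rho}_k$ a random vector in $\mathbb{R}^{n_\rho}$, $\mathbf{H}_k\in\mathbb{R}^{n_y\times n}$, $\mathbf{B}_\rho\in\mathbb{R}^{n_y\times n_\rho}$, $\mathbf{B}_v\in\mathbb{R}^{n_y\times n_v}$, $\mathbf{C}_\mu\in\mathbb{R}^{n_\mu\times n}$ are known (non-random) matrices, and $\mathbf{\Delta}_k$ is a static (memoryless) nonlinear function with values in $\mathbb{R}^{n_\rho}$. The measurement noise $\mathbf{v}_k\in\mathbb{R}^{n_v}$ is zero-mean Gaussian white noise with $\mathbb{E}(\mathbf{v}_k\mathbf{v}_k^{\mathsf T})=\mathbf{R}$, uncorrelated with $\delta\mathbf{x}_k$ and $\boldsymbol{\rho}_k$, i.e. $\mathbb{E}(\mathbf{v}_k\,\delta\mathbf{x}_k^{\mathsf T})=\mathbf{0}$ and $\mathbb{E}(\mathbf{v}_k\boldsymbol{\rho}_k^{\mathsf T})=\mathbf{0}$. Let $\mathbf{K}_k\in\mathbb{R}^{n\times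 n_y}$ be a given (non-random) gain matrix, let $\hat{\mathbf{e}}_k=\delta\mathbf{x}_k-\mathbf{K}_k\,\delta\mathbf{y}_k$ be the a posteriori state estimation error, and let $\mathbf{P}_k^-=\mathbb{E}(\delta\mathbf{x}_k\,\delta\mathbf{x}_k^{\mathsf T})$ and $\mathbf{P}_k^+=\mathbb{E}(\hat{\mathbf{e}}_k\hat{\mathbf{e}}_k^{\mathsf T})$ be the a priori and a posteriori estimation error covariances. Suppose that the quadratic constraint $$\begin{bmatrix}\delta\mathbf{x}_k\\ \boldsymbol{\rho}_k\end{bmatrix}^{\mathsf T}\mathbf{M}\begin{bmatrix}\delta\mathbf{x}_k\\ \boldsymbol{\rho}_k\end{bmatrix}\ge 0$$ holds, where $\mathbf{M}=\mathbf{U}^{\mathsf T}\mathbf{\Lambda}\mathbf{U}$, $\mathbf{U}=\mathrm{diag}(\mathbf{C}_\mu,\mathbf{1})$, and $\mathbf{\Lambda}$ is the symmetric matrix defining the quadratic constraint. If there exist $\mathbf{Z}\in\mathbb{S}^n$, $\mathbf{Y}\in\mathbb{S}^n$ and $\xi\in\mathbb{R}_{\ge 0}$ satisfying $$\begin{bmatrix}-\mathbf{Y} & \mathbf{H}_k^{\mathsf T}\mathbf{K}_k^{\mathsf T}\mathbf{Z}\mathbf{K}_k\mathbf{B}_\rho-\mathbf{Z}\mathbf{K}_k\mathbf{B}_\rho\\ \left(\mathbf{H}_k^{\mathsf T}\mathbf{K}_k^{\mathsf T}\mathbf{Z}\mathbf{K}_k\mathbf{B}_\rho-\mathbf{Z}\mathbf{K}_k\mathbf{B}_\rho\right)^{\mathsf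 T} & \mathbf{B}_\rho^{\mathsf T}\mathbf{K}_k^{\mathsf T}\mathbf{Z}\mathbf{K}_k\mathbf{B}_\rho\end{bmatrix}+\xi\,\mathbf{M}\le 0,$$ then $$\mathrm{tr}(\mathbf{P}_k^+\mathbf{Z})\le \mathrm{tr}\!\left(\mathbf{P}_k^-(\mathbf{1}-\mathbf{K}_k\mathbf{H}_k)^{\mathsf T}\mathbf{Z}(\mathbf{1}-\mathbf{K}_k\mathbf{H}_k)\right)+\mathrm{tr}(\mathbf{K}_k\mathbf{B}_v\mathbf{R}\mathbf{B}_v^{\mathsf T}\mathbf{K}_k^{\mathsf T}\mathbf{Z})+\mathrm{tr}(\mathbf{P}_k^-\mathbf{Y}).$$
   Context: $\mathbb{S}^n$ denotes the real symmetric $n\times n$ matrices. For symmetric matrices, $\le 0$ means negative semidefinite; for scalars, inequalities are the usual ones. $\mathbf{1}$ is the identity matrix, $\mathbf{0}$ is a zero matrix, $\mathrm{diag}(\cdot,\cdot)$ is a block-diagonal matrix, $\mathrm{tr}$ is the trace, and $\mathbb{E}$ is expectation. Origin of the setting: $\mathbf{x}_k$ is the true state, $\check{\mathbf{x}}_k$ the a priori estimate, $\delta\mathbf{x}_k=\mathbf{x}_k-\check{\mathbf{x}}_k$, and $\delta\mathbf{y}_k=\mathbf{y}_k-\check{\mathbf{y}}_k$ is the difference between the measurement and the predicted measurement, decomposed exactly (without approximation) into the displayed form. The a posteriori estimate is $\hat{\mathbf{x}}_k=\check{\mathbf{x}}_k+\mathbf{K}_k(\mathbf{y}_k-\check{\mathbf{y}}_k)$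 with $\mathbf{K}_k$ an available Kalman gain, so that $\hat{\mathbf{e}}_k=\mathbf{x}_k-\hat{\mathbf{x}}_k=\delta\mathbf{x}_k-\mathbf{K}_k\,\delta\mathbf{y}_k$. The quadratic constraint bounds the input-output relation of $\mathbf{\Delta}_k$: it is $\begin{bmatrix}\boldsymbol{\mu}_k\\ \boldsymbol{\rho}_k\end{bmatrix}^{\mathsf T}\mathbf{\Lambda}\begin{bmatrix}\boldsymbol{\mu}_k\\ \boldsymbol{\rho}_k\end{bmatrix}\ge 0$ rewritten in terms of $\delta\mathbf{x}_k$ and $\boldsymbol{\rho}_k$. It is assumed to hold for the realized values of $(\delta\mathbf{x}_k,\boldsymbol{\rho}_k)$ (almost surely). *)

theory Defs
  imports "HOL-Probability.Probability"
begin

text \<open>Matrices with \<open>r\<close> rows and \<open>c\<close> columns have type \<open>real ^ 'c ^ 'r\<close>.  Partitioned vectors and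
  matrices are indexed by sum types, the summands being the blocks.\<close>

definition symmetric_mat :: "real ^ 'n ^ 'n \<Rightarrow> bool" where
  "symmetric_mat A \<longleftrightarrow> transpose A = A"

definition neg_semidef :: "real ^ 'n ^ 'n \<Rightarrow> bool" where
  "neg_semidef A \<longleftrightarrow> symmetric_mat A \<and> (\<forall>x. x \<bullet> (A *v x) \<le> 0)"

definition outer :: "real ^ 'm \<Rightarrow> real ^ 'n \<Rightarrow> real ^ 'n ^ 'm" where
  "outer x y = (\<chi> i j. x $ i * y $ j)"

definition block_vec :: "real ^ 'm \<Rightarrow> real ^ 'n \<Rightarrow> real ^ ('m + 'n)" where
  "block_vec x y = (\<chi> i. case i of Inl a \<Rightarrow> x $ a | Inr b \<Rightarrow> y $ b)"

definition block_mat ::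
  "real ^ 'c ^ 'r \<Rightarrow> real ^ 'd ^ 'r \<Rightarrow> real ^ 'c ^ 's \<Rightarrow> real ^ 'd ^ 's \<Rightarrow> real ^ ('c + 'd) ^ ('r + 's)"
where
  "block_mat A B C D = (\<chi> i. case i of
       Inl a \<Rightarrow> block_vec (A $ a) (B $ a)
     | Inr b \<Rightarrow> block_vec (C $ b) (D $ b))"

definition block_diag :: "real ^ 'c ^ 'r \<Rightarrow> real ^ 'd ^ 's \<Rightarrow> real ^ ('c + 'd) ^ ('r + 's)" where
  "block_diag A D = block_mat A 0 0 D"

text \<open>Degenerate (almost surely constant) variables count as Gaussian, so that the covariance of
  a Gaussian vector may be singular.\<close>

definition gaussian_rv :: "'w measure \<Rightarrow> ('w \<Rightarrow> real) \<Rightarrow> bool" where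
  "gaussian_rv \<Omega> X \<longleftrightarrow> X \<in> borel_measurable \<Omega> \<and>
     ((\<exists>m \<sigma>. 0 < \<sigma> \<and> distributed \<Omega> lborel X (normal_density m \<sigma>)) \<or>
      (\<exists>m. AE \<omega> in \<Omega>. X \<omega> = m))"

text \<open>All finite-dimensional distributions are jointly Gaussian.\<close>

definition gaussian_process :: "'w measure \<Rightarrow> ('i \<Rightarrow> 'w \<Rightarrow> real ^ 'n) \<Rightarrow> bool" where
  "gaussian_process \<Omega> v \<longleftrightarrow> (\<forall>i. v i \<in> borel_measurable \<Omega>) \<and>
     (\<forall>J a. finite J \<longrightarrow> gaussian_rv \<Omega> (\<lambda>\<omega>. \<Sum>j\<in>J. a j \<bullet> v j \<omega>))"

text \<open>An expectation with value \<open>m\<close> is rendered by \<open>has_bochner_integral\<close>, which also asserts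
  that it exists.  Under joint Gaussianity, uncorrelatedness at distinct times is the same as
  independence.\<close>

definition gaussian_white_noise ::
  "'w measure \<Rightarrow> (nat \<Rightarrow> 'w \<Rightarrow> real ^ 'n) \<Rightarrow> real ^ 'n ^ 'n \<Rightarrow> bool"
where
  "gaussian_white_noise \<Omega> v R \<longleftrightarrow>
     gaussian_process \<Omega> v \<and>
     (\<forall>i. has_bochner_integral \<Omega> (v i) 0) \<and>
     (\<forall>i. has_bochner_integral \<Omega> (\<lambda>\<omega>. outer (v i \<omega>) (v i \<omega>)) R) \<and>
     (\<forall>i j. i \<noteq> j \<longrightarrow> has_bochner_integral \<Omega> (\<lambda>\<omega>. outer (v i \<omega>) (v j \<omega>)) 0)"

end

theory Submission
  imports Defs
begin

text \<open>
  The proof is an S-procedure argument that is carried out pointwise and then integrated.  Write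
  \<open>A = 1 - K H\<close>, \<open>p = K B\<^sub>\<rho> \<rho>\<close> and \<open>w = K B\<^sub>v v\<close>, so that the posterior error is
  \<open>e = A dx - p - w\<close> almost surely.  Expanding \<open>e\<^sup>T Z e\<close> gives the nominal term
  \<open>dx\<^sup>T A\<^sup>T Z A dx\<close>, the noise term \<open>w\<^sup>T Z w\<close>, cross terms that pair \<open>v\<close> with \<open>dx\<close> or with \<open>\<rho>\<close>,
  and the part \<open>2 dx\<^sup>T S \<rho> + p\<^sup>T Z p\<close>, because \<open>S = - A\<^sup>T Z K B\<^sub>\<rho>\<close>.  This last part is the quadratic
  form of the first matrix in the matrix inequality, with \<open>dx\<^sup>T Y dx\<close> added back.  The matrix
  inequality and the quadratic constraint together bound it by \<open>dx\<^sup>T Y dx\<close>: the multiplier term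
  \<open>\<xi> q\<^sup>T M q\<close>, where \<open>q\<close> stacks \<open>dx\<close> and \<open>\<rho>\<close>, is nonnegative and can be dropped
  (lemma \<open>s_procedure_bound\<close>).

  Each of the remaining terms is a fixed bilinear form in two random vectors, so its expectation is
  the trace of the corresponding second moment matrix times the matrix of the form (lemma
  \<open>has_bochner_integral_bilinear\<close>); the cross terms have expectation zero.
\<close>

lemma inner_block_vec:
  "block_vec a b \<bullet> block_vec c d = a \<bullet> c + b \<bullet> d"
  by (simp add: inner_vec_def block_vec_def UNIV_Plus_UNIV[symmetric] sum.Plus
      del: UNIV_Plus_UNIV)

lemma block_mat_mult_block_vec:
  "block_mat A B C D *v block_vec x y = block_vec (A *v x + B *v y) (C *v x + D *v y)"
proof -
  have row: "(\<Sum>j\<in>UNIV. block_vec a b $ j * block_vec x y $ j)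
      = (\<Sum>j\<in>UNIV. a $ j * x $ j) + (\<Sum>j\<in>UNIV. b $ j * y $ j)" for a b
    using inner_block_vec[of a b x y] by (simp add: inner_vec_def)
  show ?thesis
    by (subst vec_eq_iff)
      (auto simp: matrix_vector_mult_def block_mat_def row block_vec_def[of "_ + _"]
        block_vec_def[of "vec_lambda _"] split: sum.split)
qed

lemma inner_transpose_mult:
  fixes A :: "real ^ 'c ^ 'r"
  shows "x \<bullet> (transpose A *v y) = (A *v x) \<bullet> y"
  by (metis dot_lmul_matrix transpose_matrix_vector inner_commute)

lemma inner_symmetric_mat:
  "symmetric_mat Z \<Longrightarrow> x \<bullet> (Z *v y) = y \<bullet> (Z *v x)"
  by (metis inner_transpose_mult symmetric_mat_def inner_commute)

text \<open>Symmetry of the block matrix merges the two off-diagonal blocks into one doubled cross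
  term.\<close>

lemma quadratic_form_block_mat:
  "block_vec x y \<bullet> (block_mat A S (transpose S) G *v block_vec x y)
    = x \<bullet> (A *v x) + 2 * (x \<bullet> (S *v y)) + y \<bullet> (G *v y)"
  by (simp add: block_mat_mult_block_vec inner_block_vec inner_add_right inner_transpose_mult
      inner_commute[of "S *v y"] del: transpose_matrix_vector)

text \<open>The S-procedure at a single point: where the constraint form is nonnegative, semidefiniteness
  of the block matrix plus a nonnegative multiple of \<open>M\<close> leaves only the slack \<open>Y\<close>.\<close>

lemma s_procedure_bound:
  assumes "neg_semidef (block_mat (- Y) S (transpose S) G + \<xi> *\<^sub>R M)"
    and "0 \<le> \<xi>" and "0 \<le> block_vec x y \<bullet> (M *v block_vec x y)"
  shows "2 * (x \<bullet> (S *v y)) + y \<bullet> (G *v y) \<le> x \<bullet> (Y *v x)"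
proof -
  let ?q = "block_vec x y"
  have "?q \<bullet> ((block_mat (- Y) S (transpose S) G + \<xi> *\<^sub>R M) *v ?q) \<le> 0"
    using assms(1) unfolding neg_semidef_def by blast
  moreover have "(- Y) *v x = - (Y *v x)"
    using matrix_vector_mult_diff_rdistrib[of 0 Y x] by simp
  ultimately have "- (x \<bullet> (Y *v x)) + 2 * (x \<bullet> (S *v y)) + y \<bullet> (G *v y) + \<xi> * (?q \<bullet> (M *v ?q)) \<le> 0"
    by (simp add: matrix_vector_mult_add_rdistrib inner_add_right quadratic_form_block_mat
        scaleR_matrix_vector_assoc[symmetric])
  moreover have "0 \<le> \<xi> * (?q \<bullet> (M *v ?q))"
    using assms(2,3) by simp
  ultimately show ?thesis by linarith
qed

lemma trace_outer_mult:
  fixes x :: "real ^ 'm" and y :: "real ^ 'n" and W :: "real ^ 'm ^ 'n"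
  shows "trace (outer x y ** W) = y \<bullet> (W *v x)"
proof -
  have "trace (outer x y ** W) = (\<Sum>i\<in>UNIV. \<Sum>j\<in>UNIV. y $ j * (W $ j $ i * x $ i))"
    by (simp add: trace_def outer_def matrix_matrix_mult_def mult_ac)
  also have "\<dots> = (\<Sum>j\<in>UNIV. \<Sum>i\<in>UNIV. y $ j * (W $ j $ i * x $ i))"
    by (rule sum.swap)
  also have "\<dots> = y \<bullet> (W *v x)"
    by (simp add: inner_vec_def matrix_vector_mult_def sum_distrib_left)
  finally show ?thesis .
qed

text \<open>A bilinear form in two random vectors is a linear functional of their outer product, and
  expectation commutes with bounded linear functionals.\<close>

lemma has_bochner_integral_bilinear:
  fixes W :: "real ^ 'm ^ 'n"
  assumes "has_bochner_integral \<Omega> (\<lambda>\<omega>. outer (X \<omega>) (Y \<omega>)) P"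
  shows "has_bochner_integral \<Omega> (\<lambda>\<omega>. Y \<omega> \<bullet> (W *v X \<omega>)) (trace (P ** W))"
proof -
  have "linear (\<lambda>Q :: real ^ 'n ^ 'm. trace (Q ** W))"
    by (rule linearI)
      (simp_all add: trace_def matrix_matrix_mult_def sum.distrib sum_distrib_left
        algebra_simps)
  then have "bounded_linear (\<lambda>Q :: real ^ 'n ^ 'm. trace (Q ** W))"
    by (rule linear_conv_bounded_linear[THEN iffD1])
  from has_bochner_integral_bounded_linear[OF this assms] show ?thesis
    by (simp add: trace_outer_mult)
qed

text \<open>Symmetry of \<open>Z\<close> merges the mixed products, and \<open>S = - A\<^sup>T Z K B\<close> absorbs the sign of the
  product of \<open>A x\<close> with \<open>K B r\<close>.  The \<open>S\<close> term and the square in \<open>r\<close> are what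
  \<open>s_procedure_bound\<close> controls; every other term is written as one matrix between two of the
  vectors, the form in which \<open>has_bochner_integral_bilinear\<close> gives its expectation.\<close>

lemma weighted_error_expansion:
  fixes H :: "real ^ 'n ^ 'y" and K :: "real ^ 'y ^ 'n" and B :: "real ^ 'r ^ 'y"
    and D :: "real ^ 'v ^ 'y" and Z :: "real ^ 'n ^ 'n"
  assumes Z: "symmetric_mat Z"
    and S: "S = transpose H ** transpose K ** Z ** K ** B - Z ** K ** B"
    and A: "A = mat 1 - K ** H"
    and e: "e = x - K *v (H *v x + B *v r + D *v u)"
  shows "e \<bullet> (Z *v e)
      = x \<bullet> ((transpose A ** Z ** A) *v x)
        + 2 * (x \<bullet> (S *v r)) + r \<bullet> ((transpose B ** transpose K ** Z ** K ** B) *v r)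
        + u \<bullet> ((transpose D ** transpose K ** Z ** K ** D) *v u)
        - 2 * (x \<bullet> ((transpose A ** Z ** K ** D) *v u))
        + 2 * (r \<bullet> ((transpose B ** transpose K ** Z ** K ** D) *v u))"
proof -
  define a p w where "a = A *v x" and "p = K *v (B *v r)" and "w = K *v (D *v u)"
  have e': "e = a - p - w"
    by (simp add: e a_def p_def w_def A matrix_vector_mult_diff_rdistrib
        matrix_vector_right_distrib matrix_vector_mul_assoc)
  have "x \<bullet> (S *v r) = (K *v (H *v x)) \<bullet> (Z *v p) - x \<bullet> (Z *v p)"
    by (simp add: S p_def matrix_vector_mult_diff_rdistrib inner_diff_right inner_transpose_mult
        flip: matrix_vector_mul_assoc del: transpose_matrix_vector)
  also have "\<dots> = - (a \<bullet> (Z *v p))"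
    by (simp add: a_def A matrix_vector_mult_diff_rdistrib inner_diff_left
        matrix_vector_mul_assoc)
  finally have S': "x \<bullet> (S *v r) = - (a \<bullet> (Z *v p))" .
  have "e \<bullet> (Z *v e) = a \<bullet> (Z *v a) - 2 * (a \<bullet> (Z *v p)) + p \<bullet> (Z *v p) + w \<bullet> (Z *v w)
      - 2 * (a \<bullet> (Z *v w)) + 2 * (p \<bullet> (Z *v w))"
    using inner_symmetric_mat[OF Z, of p a] inner_symmetric_mat[OF Z, of w a]
      inner_symmetric_mat[OF Z, of w p]
    by (simp add: e' matrix_vector_mult_diff_distrib inner_diff_left inner_diff_right)
  then show ?thesis
    by (simp add: S' a_def p_def w_def inner_transpose_mult
        flip: matrix_vector_mul_assoc del: transpose_matrix_vector)
qed


theorem mainTheorem2: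
  fixes \<Omega> :: "'w measure"
    and k :: nat
    and dx e_hat :: "nat \<Rightarrow> 'w \<Rightarrow> real ^ 'n"
    and dy :: "nat \<Rightarrow> 'w \<Rightarrow> real ^ 'y"
    and \<rho> :: "nat \<Rightarrow> 'w \<Rightarrow> real ^ 'r"
    and \<mu> :: "nat \<Rightarrow> 'w \<Rightarrow> real ^ 'm"
    and v :: "nat \<Rightarrow> 'w \<Rightarrow> real ^ 'v"
    and H :: "nat \<Rightarrow> real ^ 'n ^ 'y"
    and K :: "nat \<Rightarrow> real ^ 'y ^ 'n"
    and B\<rho> :: "real ^ 'r ^ 'y"
    and Bv :: "real ^ 'v ^ 'y"
    and C\<mu> :: "real ^ 'n ^ 'm"
    and \<Delta> :: "nat \<Rightarrow> real ^ 'm \<Rightarrow> real ^ 'r"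
    and R :: "real ^ 'v ^ 'v"
    and P_minus P_plus :: "nat \<Rightarrow> real ^ 'n ^ 'n"
    and \<Lambda> :: "real ^ ('m + 'r) ^ ('m + 'r)"
    and U :: "real ^ ('n + 'r) ^ ('m + 'r)"
    and M :: "real ^ ('n + 'r) ^ ('n + 'r)"
    and Y Z :: "real ^ 'n ^ 'n"
    and S :: "real ^ 'r ^ 'n"
    and \<xi> :: real
  assumes prob: "prob_space \<Omega>"
    and dx_rv: "dx k \<in> borel_measurable \<Omega>"
    and dy_rv: "dy k \<in> borel_measurable \<Omega>"
    and rho_rv: "\<rho> k \<in> borel_measurable \<Omega>"
    and dy_eq: "AE \<omega> in \<Omega>. dy k \<omega> = H k *v dx k \<omega> + B\<rho> *v \<rho> k \<omega> + Bv *v v k \<omega>"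
    and rho_eq: "AE \<omega> in \<Omega>. \<rho> k \<omega> = \<Delta> k (\<mu> k \<omega>)"
    and mu_eq: "AE \<omega> in \<Omega>. \<mu> k \<omega> = C\<mu> *v dx k \<omega>"
    and noise: "gaussian_white_noise \<Omega> v R"
    and v_dx: "has_bochner_integral \<Omega> (\<lambda>\<omega>. outer (v k \<omega>) (dx k \<omega>)) 0"
    and v_rho: "has_bochner_integral \<Omega> (\<lambda>\<omega>. outer (v k \<omega>) (\<rho> k \<omega>)) 0"
    and e_hat: "e_hat k = (\<lambda>\<omega>. dx k \<omega> - K k *v dy k \<omega>)"
    and P_minus: "has_bochner_integral \<Omega> (\<lambda>\<omega>. outer (dx k \<omega>) (dx k \<omega>)) (P_minus k)"
    and P_plus: "has_bochner_integral \<Omega> (\<lambda>\<omega>. outer (e_hat k \<omega>) (e_hat k \<omega>)) (P_plus k)"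
    and Lambda_sym: "symmetric_mat \<Lambda>"
    and U: "U = block_diag C\<mu> (mat 1)"
    and M: "M = transpose U ** \<Lambda> ** U"
    and qc: "AE \<omega> in \<Omega>. block_vec (dx k \<omega>) (\<rho> k \<omega>) \<bullet> (M *v block_vec (dx k \<omega>) (\<rho> k \<omega>)) \<ge> 0"
    and Z_sym: "symmetric_mat Z"
    and Y_sym: "symmetric_mat Y"
    and xi: "\<xi> \<ge> 0"
    and S: "S = transpose (H k) ** transpose (K k) ** Z ** K k ** B\<rho> - Z ** K k ** B\<rho>"
    and lmi: "neg_semidef
        (block_mat (- Y) S
                   (transpose S) (transpose B\<rho> ** transpose (K k) ** Z ** K k ** B\<rho>)
         + \<xi> *\<^sub>R M)"
  shows "trace (P_plus k ** Z)
      \<le> trace (P_minus k ** transpose (mat 1 - K k ** H k) ** Z ** (mat 1 - K k ** H k))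
        + trace (K k ** Bv ** R ** transpose Bv ** transpose (K k) ** Z)
        + trace (P_minus k ** Y)"
proof -
  define A where "A = mat 1 - K k ** H k"
  define G where "G = transpose Bv ** transpose (K k) ** Z ** K k ** Bv"
  define Wx where "Wx = transpose A ** Z ** K k ** Bv"
  define Wr where "Wr = transpose B\<rho> ** transpose (K k) ** Z ** K k ** Bv"
  let ?e = "\<lambda>\<omega>. e_hat k \<omega> \<bullet> (Z *v e_hat k \<omega>)"
  let ?bound = "\<lambda>\<omega>. dx k \<omega> \<bullet> ((transpose A ** Z ** A) *v dx k \<omega>) + dx k \<omega> \<bullet> (Y *v dx k \<omega>)
      + v k \<omega> \<bullet> (G *v v k \<omega>)
      - 2 * (dx k \<omega> \<bullet> (Wx *v v k \<omega>)) + 2 * (\<rho> k \<omega> \<bullet> (Wr *v v k \<omega>))"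
  have pointwise: "AE \<omega> in \<Omega>. ?e \<omega> \<le> ?bound \<omega>"
    using dy_eq qc
  proof eventually_elim
    case (elim \<omega>)
    have "e_hat k \<omega> = dx k \<omega> - K k *v (H k *v dx k \<omega> + B\<rho> *v \<rho> k \<omega> + Bv *v v k \<omega>)"
      using elim(1) by (simp add: e_hat)
    from weighted_error_expansion[OF Z_sym S A_def this] s_procedure_bound[OF lmi xi elim(2)]
    show ?case by (simp add: G_def Wx_def Wr_def)
  qed
  have R: "has_bochner_integral \<Omega> (\<lambda>\<omega>. outer (v k \<omega>) (v k \<omega>)) R"
    using noise unfolding gaussian_white_noise_def by blast
  have e_int: "has_bochner_integral \<Omega> ?e (trace (P_plus k ** Z))"
    by (rule has_bochner_integral_bilinear[OF P_plus])
  have "has_bochner_integral \<Omega> ?bound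
      (trace (P_minus k ** (transpose A ** Z ** A)) + trace (P_minus k ** Y) + trace (R ** G)
        - 2 * trace ((0 :: real ^ 'n ^ 'v) ** Wx) + 2 * trace ((0 :: real ^ 'r ^ 'v) ** Wr))"
    by (intro has_bochner_integral_add has_bochner_integral_diff has_bochner_integral_mult_right
        has_bochner_integral_bilinear P_minus R v_dx v_rho)
  then have bound_int: "has_bochner_integral \<Omega> ?bound
      (trace (P_minus k ** (transpose A ** Z ** A)) + trace (P_minus k ** Y) + trace (R ** G))"
    by simp
  have "trace (P_plus k ** Z)
      \<le> trace (P_minus k ** (transpose A ** Z ** A)) + trace (P_minus k ** Y) + trace (R ** G)"
    using integral_mono_AE[OF _ _ pointwise] e_int bound_int
    by (simp only: has_bochner_integral_iff)
  moreover have "trace (R ** G) = trace (K k ** Bv ** R ** transpose Bv ** transpose (K k) ** Z)"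
    using trace_mul_sym[of "R ** transpose Bv ** transpose (K k) ** Z" "K k ** Bv"]
    by (simp add: G_def matrix_mul_assoc)
  ultimately show ?thesis
    by (simp add: A_def matrix_mul_assoc)
qed

end
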